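(* For every integer $k \geq 0$, there exists a $k$-uniform cubefree binary morphism $h : \{0,1\}^* \to \{0,1\}^*$.
   Context: $\Sigma^*$ denotes the set of all finite words (including the empty word) over the alphabet $\Sigma$; a morphism $h:\Sigma^*\to\Sigma^*$ is a map with $h(uv)=h(u)h(v)$ for all $u,v\in\Sigma^*$. A binary morphism is a morphism with $\Sigma=\{0,1\}$. A morphism $h$ is $k$-uniform if $h(a)$ has length $k$ for all letters $a\in\Sigma$. A cube is a non-empty word of the form $xxx$. A word is cubefree if none of its factors (contiguous subwords) is a cube. A morphism $h:\Sigma^*\to\Sigma^*$ is cubefree if $h(w)$ is cubefree whenever $w\in\Sigma^*$ is cubefree. *)

theory Defs
  imports Main "HOL-Library.Sublist" "HOL-Library.FuncSet"
begin

definition morphism_on :: "'a set \<Rightarrow> ('a list \<Rightarrow> 'a list) \<Rightarrow> bool" where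
  "morphism_on \<Sigma> h \<longleftrightarrow>
     h \<in> lists \<Sigma> \<rightarrow> lists \<Sigma> \<and>
     (\<forall>u\<in>lists \<Sigma>. \<forall>v\<in>lists \<Sigma>. h (u @ v) = h u @ h v)"

definition uniform_on :: "'a set \<Rightarrow> nat \<Rightarrow> ('a list \<Rightarrow> 'a list) \<Rightarrow> bool" where
  "uniform_on \<Sigma> k h \<longleftrightarrow> (\<forall>a\<in>\<Sigma>. length (h [a]) = k)"

definition cube :: "'a list \<Rightarrow> bool" where
  "cube w \<longleftrightarrow> w \<noteq> [] \<and> (\<exists>x. w = x @ x @ x)"

(* sublist (from HOL-Library.Sublist) is the contiguous factor relation, not the subsequence one *)
definition cubefree :: "'a list \<Rightarrow> bool" where
  "cubefree w \<longleftrightarrow> \<not> (\<exists>u. sublist u w \<and> cube u)"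

definition cubefree_morphism_on :: "'a set \<Rightarrow> ('a list \<Rightarrow> 'a list) \<Rightarrow> bool" where
  "cubefree_morphism_on \<Sigma> h \<longleftrightarrow>
     morphism_on \<Sigma> h \<and> (\<forall>w\<in>lists \<Sigma>. cubefree w \<longrightarrow> cubefree (h w))"

end

theory Submission
  imports Defs
begin

text \<open>If the period of every cube in the image of a cubefree word is a multiple of \<open>k\<close>, then a
  \<open>k\<close>-uniform binary morphism with two different blocks is cubefree. Lengths are multiplicative under
  composition, and the Thue-Morse morphism has length 2, so odd \<open>k\<close> remain. In the Thue-Morse word
  \<open>00\<close> occurs at odd positions only, so \<open>00100\<close> is not a factor and can serve as a marker for the
  block boundaries: use blocks \<open>00100 u\<close> where \<open>100 u 001\<close> is a Thue-Morse factor. A cube of period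
  at least 4 containing a marker has a period divisible by \<open>k\<close>; without a marker it would lie, up to
  one letter at either end, in a Thue-Morse factor and yield an overlap there. For odd \<open>k \<ge> 45\<close> a
  recursion on the length provides two different such \<open>u\<close> of length \<open>k - 5\<close>. Smaller odd \<open>k\<close> are
  products of primes for which explicit blocks are checked.\<close>


section \<open>Cubes described by position and period\<close>

definition cube_at :: "'a list \<Rightarrow> nat \<Rightarrow> nat \<Rightarrow> bool" where
  "cube_at w i p \<longleftrightarrow> 0 < p \<and> i + 3 * p \<le> length w \<and> (\<forall>j<2 * p. w ! (i + j) = w ! (i + j + p))"

text \<open>Three equal copies of \<open>x\<close> amount to period \<open>length x\<close> on a
  window three times as long, so factors can be replaced by indices and periods compared with the
  block length.\<close>

lemma cubefree_iff_cube_at: "cubefree w \<longleftrightarrow> (\<forall>i p. \<not> cube_at w i p)"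
proof -
  have "\<exists>u. sublist u w \<and> cube u" if "cube_at w i p" for i p
  proof -
    define x where "x = take p (drop i w)"
    have p: "0 < p" "i + 3 * p \<le> length w"
      and eq: "\<And>j. j < 2 * p \<Longrightarrow> w ! (i + j) = w ! (i + j + p)"
      using that by (auto simp: cube_at_def)
    have len: "length x = p" using p by (simp add: x_def)
    have "take (3 * p) (drop i w) = x @ x @ x"
    proof (rule nth_equalityI)
      show "length (take (3 * p) (drop i w)) = length (x @ x @ x)" using p len by simp
    next
      fix j assume "j < length (take (3 * p) (drop i w))"
      then have j: "j < 3 * p" by simp
      consider "j < p" | "p \<le> j" "j < 2 * p" | "2 * p \<le> j" by linarith
      then show "take (3 * p) (drop i w) ! j = (x @ x @ x) ! j"
      proof cases
        case 1
        then show ?thesis using p len by (simp add: nth_append x_def)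
      next
        case 2
        then have "j - p < p" by linarith
        then show ?thesis using 2 p len eq[of "j - p"] by (simp add: nth_append x_def)
      next
        case 3
        then have "j - p < 2 * p" "j - 2 * p < p" "\<not> j - p < p" using j by linarith+
        then show ?thesis using 3 p len j eq[of "j - p"] eq[of "j - 2 * p"]
          by (simp add: nth_append x_def mult_2)
      qed
    qed
    moreover have "sublist (take (3 * p) (drop i w)) w"
      by (metis append_take_drop_id sublist_appendI)
    moreover have "x \<noteq> []" using len p by auto
    ultimately show ?thesis by (auto simp: cube_def)
  qed
  moreover have "\<exists>i p. cube_at w i p" if "sublist u w" "cube u" for u
  proof -
    obtain x where "u = x @ x @ x" using \<open>cube u\<close> unfolding cube_def by blast
    moreover from this have "x \<noteq> []" using \<open>cube u\<close> by (auto simp: cube_def)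
    ultimately have x: "x \<noteq> []" "u = x @ x @ x" by blast+
    obtain ps ss where w: "w = ps @ u @ ss"
      using \<open>sublist u w\<close> by (auto simp: sublist_def)
    have "cube_at w (length ps) (length x)"
      using x by (auto simp: cube_at_def w nth_append)
    then show ?thesis by blast
  qed
  ultimately show ?thesis unfolding cubefree_def by blast
qed

section \<open>Lengths of uniform cubefree morphisms and their products\<close>

definition cubefree_length :: "nat \<Rightarrow> bool" where
  "cubefree_length k \<longleftrightarrow>
     (\<exists>h :: nat list \<Rightarrow> nat list. cubefree_morphism_on {0, 1} h \<and> uniform_on {0, 1} k h)"

lemma cubefree_length_0: "cubefree_length 0"
  unfolding cubefree_length_def
  by (rule exI[of _ "\<lambda>_. []"])
    (auto simp: cubefree_morphism_on_def morphism_on_def uniform_on_def cubefree_def cube_def)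

lemma cubefree_length_1: "cubefree_length 1"
  unfolding cubefree_length_def
  by (rule exI[of _ "\<lambda>w. w"])
    (auto simp: cubefree_morphism_on_def morphism_on_def uniform_on_def)

lemma morphism_on_Nil:
  assumes "morphism_on \<Sigma> h"
  shows "h [] = []"
proof -
  have "h ([] @ []) = h [] @ h []" using assms unfolding morphism_on_def by blast
  then show ?thesis by simp
qed

lemma length_uniform_morphism:
  assumes "morphism_on \<Sigma> h" "uniform_on \<Sigma> k h" "w \<in> lists \<Sigma>"
  shows "length (h w) = k * length w"
  using assms(3)
proof (induction w)
  case Nil
  then show ?case using morphism_on_Nil[OF assms(1)] by simp
next
  case (Cons a w)
  have "h ([a] @ w) = h [a] @ h w"
    using assms(1) Cons.hyps lists.Nil[of \<Sigma>] lists.Cons[of a \<Sigma> "[]"]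
    unfolding morphism_on_def by metis
  then show ?case using Cons assms(2) by (simp add: uniform_on_def)
qed

lemma cubefree_length_mult:
  assumes "cubefree_length k" "cubefree_length l"
  shows "cubefree_length (k * l)"
proof -
  obtain g :: "nat list \<Rightarrow> nat list" where g: "cubefree_morphism_on {0, 1} g" "uniform_on {0, 1} k g"
    using assms(1) unfolding cubefree_length_def by blast
  obtain h :: "nat list \<Rightarrow> nat list" where h: "cubefree_morphism_on {0, 1} h" "uniform_on {0, 1} l h"
    using assms(2) unfolding cubefree_length_def by blast
  have hl: "h u \<in> lists {0, 1}" if "u \<in> lists {0, 1}" for u
    using h(1) that unfolding cubefree_morphism_on_def morphism_on_def by blast
  have "morphism_on {0, 1} (g \<circ> h)"
    using g(1) h(1) unfolding cubefree_morphism_on_def morphism_on_def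
    by (auto simp: Pi_iff simp del: lists_eq_set insert_iff)
  moreover have "cubefree ((g \<circ> h) w)" if "w \<in> lists {0, 1}" "cubefree w" for w
    using g(1) h(1) that hl unfolding cubefree_morphism_on_def by simp
  moreover have "length ((g \<circ> h) [a]) = k * l" if "a \<in> {0, 1}" for a
    using length_uniform_morphism[of "{0,1}" g k "h [a]"] g h(2) hl[of "[a]"] that
    unfolding cubefree_morphism_on_def uniform_on_def by auto
  ultimately show ?thesis
    unfolding cubefree_length_def cubefree_morphism_on_def uniform_on_def by blast
qed

section \<open>Block substitutions over a binary alphabet\<close>

locale binary_blocks =
  fixes B :: "nat \<Rightarrow> nat list" and k :: nat
  assumes set_block: "a \<in> {0, 1} \<Longrightarrow> set (B a) \<subseteq> {0, 1}"
    and length_block: "a \<in> {0, 1} \<Longrightarrow> length (B a) = k"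
    and distinct_blocks: "B 0 \<noteq> B 1"
begin

definition subst :: "nat list \<Rightarrow> nat list" where
  "subst w = concat (map B w)"

lemma k_pos: "0 < k"
  using distinct_blocks length_block[of 0] length_block[of 1] by (cases k) auto

lemma length_subst: "w \<in> lists {0, 1} \<Longrightarrow> length (subst w) = k * length w"
  unfolding subst_def by (induction w) (auto simp: length_block)

lemma subst_nth:
  assumes "w \<in> lists {0, 1}" "q < length w" "x < k"
  shows "subst w ! (k * q + x) = B (w ! q) ! x"
  using assms
proof (induction w arbitrary: q)
  case (Cons a w)
  then have "length (B a) = k" using length_block by blast
  then show ?case using Cons by (cases q) (auto simp: subst_def nth_append)
qed simp

text \<open>Local checks need two blocks after block \<open>q\<close> even if \<open>w\<close> ends
  too early. Padding \<open>w\<close> with two zeros supplies \<open>b\<close> and \<open>c\<close>;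
  only positions inside the real image are compared.\<close>

lemma subst_nth_triple:
  assumes w: "w \<in> lists {0, 1}" and q: "q < length w"
  obtains b c where "b \<in> {0, 1}" "c \<in> {0, 1}"
    "\<And>x. x < 3 * k \<Longrightarrow> k * q + x < k * length w \<Longrightarrow>
      subst w ! (k * q + x) = (B (w ! q) @ B b @ B c) ! x"
proof -
  obtain b c v where v: "drop q w @ [0, 0] = w ! q # b # c # v"
  proof (cases "drop (Suc q) w @ [0, 0]")
    case (Cons b t)
    then show ?thesis using that[of b "hd t" "tl t"] Cons_nth_drop_Suc[OF q, symmetric]
      by (cases t) (auto simp: append_eq_Cons_conv)
  qed simp
  have "set (drop q w @ [0, 0]) \<subseteq> {0, 1}" using w set_drop_subset[of q w] by auto
  then have letters: "w ! q \<in> {0, 1}" "b \<in> {0, 1}" "c \<in> {0, 1}" unfolding v by auto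
  have "take q w \<in> lists {0, 1}" using w set_take_subset[of q w] by auto
  then have len: "length (subst (take q w)) = k * q" using length_subst q by simp
  have "subst w ! (k * q + x) = (B (w ! q) @ B b @ B c) ! x"
    if x: "x < 3 * k" "k * q + x < k * length w" for x
  proof -
    have "subst w ! (k * q + x) = (subst w @ subst [0, 0]) ! (k * q + x)"
      using x(2) length_subst[OF w] by (simp add: nth_append)
    also have "subst w @ subst [0, 0] = subst (take q w) @ subst (drop q w @ [0, 0])"
      using append_take_drop_id[of q w]
      by (metis subst_def map_append concat_append append_assoc)
    also have "\<dots> ! (k * q + x) = ((B (w ! q) @ B b @ B c) @ subst v) ! x"
      unfolding v using len by (simp add: nth_append subst_def)
    also have "\<dots> = (B (w ! q) @ B b @ B c) ! x"
      using x(1) letters by (simp add: nth_append length_block del: insert_iff append_assoc)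
    finally show ?thesis .
  qed
  then show ?thesis using that letters by blast
qed

text \<open>A cube of period \<open>k * m\<close> in the image, starting inside a block, gives a letter word
  \<open>a0 v a1 v a1 v a3\<close>; as the alphabet is binary, either it contains a cube, or \<open>a0 = a3 \<noteq> a1\<close>
  and the blocks of \<open>a0\<close> and \<open>a1\<close> agree.\<close>

lemma cube_period_not_dvd:
  assumes w: "w \<in> lists {0, 1}" "cubefree w" and c: "cube_at (subst w) i p"
  shows "\<not> k dvd p"
proof
  assume "k dvd p"
  then obtain m where m: "p = k * m" by blast
  have p: "0 < p" "i + 3 * p \<le> k * length w"
    and eq: "\<And>j. j < 2 * p \<Longrightarrow> subst w ! (i + j) = subst w ! (i + j + p)"
    using c length_subst[OF w(1)] by (auto simp: cube_at_def)
  have m0: "0 < m" using p m by simp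
  define q r where "q = i div k" and "r = i mod k"
  have i: "i = k * q + r" and r: "r < k" using k_pos by (simp_all add: q_def r_def)
  have bnd: "q + 3 * m \<le> length w" and bnd': "r > 0 \<Longrightarrow> q + 3 * m < length w"
  proof -
    have "k * (q + 3 * m) + r \<le> k * length w" using p(2) i m by (simp add: algebra_simps)
    then have "k * (q + 3 * m) \<le> k * length w" and "r > 0 \<Longrightarrow> k * (q + 3 * m) < k * length w"
      by linarith+
    then show "q + 3 * m \<le> length w" and "r > 0 \<Longrightarrow> q + 3 * m < length w"
      using k_pos by simp_all
  qed
  have agree: "B (w ! (q + s)) ! x = B (w ! (q + s + m)) ! x"
    if "x < k" "q + s + m < length w" "r \<le> k * s + x" "k * s + x < r + 2 * p" for s x
  proof -
    have "subst w ! (k * (q + s) + x) = subst w ! (k * (q + s + m) + x)"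
      using eq[of "k * s + x - r"] that i m by (simp add: algebra_simps)
    then show ?thesis using that subst_nth[OF w(1)] by simp
  qed
  have letter: "w ! n \<in> {0, 1}" if "n < length w" for n using w(1) that by auto
  have inj: "a = b" if "a \<in> {0, 1}" "b \<in> {0, 1}" "\<And>x. x < k \<Longrightarrow> B a ! x = B b ! x" for a b
  proof -
    have "B a = B b"
      using that length_block[of a] length_block[of b] by (intro nth_equalityI) simp_all
    then show ?thesis using that(1,2) distinct_blocks by auto
  qed
  have inner: "w ! (q + s) = w ! (q + s + m)"
    if "q + s + m < length w" "r \<le> k * s" "k * s + k \<le> r + 2 * p" for s
  proof (rule inj)
    show "w ! (q + s) \<in> {0, 1}" "w ! (q + s + m) \<in> {0, 1}"
      using that(1) by (simp_all only: letter add_lessD1[of "q + s" m])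
    show "B (w ! (q + s)) ! x = B (w ! (q + s + m)) ! x" if "x < k" for x
      by (rule agree) (use that \<open>q + s + m < length w\<close> \<open>r \<le> k * s\<close> \<open>k * s + k \<le> r + 2 * p\<close> in linarith)+
  qed
  have no_cube: False if "n + 3 * m \<le> length w" "\<And>j. j < 2 * m \<Longrightarrow> w ! (n + j) = w ! (n + j + m)" for n
    using w(2) that m0 unfolding cubefree_iff_cube_at cube_at_def by blast
  \<comment> \<open>Only the first and the last pair of compared blocks can be cut by the ends of
    the cube; for \<open>s\<close> strictly between 0 and \<open>2 * m\<close> whole blocks are
    compared.\<close>
  have mid: "w ! (q + s) = w ! (q + s + m)" if "1 \<le> s" "s < 2 * m" for s
  proof (rule inner)
    show "q + s + m < length w" using that bnd by linarith
    have "k \<le> k * s" using that by (cases s) auto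
    then show "r \<le> k * s" using r by linarith
    have "k * (s + 1) \<le> k * (2 * m)" using that by (intro mult_le_mono) auto
    then show "k * s + k \<le> r + 2 * p" using m by (simp add: algebra_simps)
  qed
  show False
  proof (cases "w ! q = w ! (q + m)")
    case True
    have "w ! (q + j) = w ! (q + j + m)" if "j < 2 * m" for j
      using that mid[of j] True by (cases "j = 0") auto
    then show False using no_cube[of q] bnd by blast
  next
    case ne: False
    have r0: "r > 0"
    proof (rule ccontr)
      assume "\<not> r > 0"
      then show False using inner[of 0] ne bnd m0 m by simp
    qed
    then have bd: "q + 3 * m < length w" using bnd' by blast
    show False
    proof (cases "w ! (q + 2 * m) = w ! (q + 3 * m)")
      case True
      have "w ! (q + 1 + j) = w ! (q + 1 + j + m)" if "j < 2 * m" for j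
      proof (cases "j + 1 = 2 * m")
        case last: True
        then have "q + 1 + j = q + 2 * m" "q + 1 + j + m = q + 3 * m" by linarith+
        then show ?thesis using True by (simp only:)
      next
        case False
        then show ?thesis using that mid[of "j + 1"] by (simp add: algebra_simps)
      qed
      then show False using no_cube[of "q + 1"] bd by (metis Suc_eq_plus1 add_Suc less_eq_Suc_le)
    next
      case ne2: False
      have e1: "w ! (q + m) = w ! (q + 2 * m)" using mid[of m] m0 by (simp add: mult_2 add.assoc)
      have l: "w ! q \<in> {0, 1}" "w ! (q + m) \<in> {0, 1}" "w ! (q + 3 * m) \<in> {0, 1}"
        using bd by (auto intro!: letter simp del: insert_iff One_nat_def)
      have e2: "w ! (q + 3 * m) = w ! q" using l ne ne2 e1 by auto
      \<comment> \<open>The cube compares the letters before offset \<open>r\<close> in the last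
        pair of blocks and those from \<open>r\<close> on in the first pair; by \<open>e1\<close>
        and \<open>e2\<close> both pairs consist of the same two blocks.\<close>
      have "B (w ! q) ! x = B (w ! (q + m)) ! x" if "x < k" for x
      proof (cases "x < r")
        case True
        have "k \<le> k * (2 * m)" using m0 by (cases m) auto
        moreover have "q + 2 * m + m = q + 3 * m" by simp
        moreover have "k * (2 * m) = 2 * p" using m by simp
        ultimately have "B (w ! (q + 2 * m)) ! x = B (w ! (q + 3 * m)) ! x"
          using agree[of x "2 * m"] True bd r by (metis add_lessD1 add_less_mono1 add.commute le_add1 less_imp_le_nat order_trans that)
        then show ?thesis using e1 e2 by simp
      next
        case False
        have "k \<le> p" using m m0 by (cases m) auto
        then have "B (w ! (q + 0)) ! x = B (w ! (q + 0 + m)) ! x"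
          using False that bd by (intro agree) linarith+
        then show ?thesis by simp
      qed
      then show False using inj l ne by blast
    qed
  qed
qed

text \<open>Periods divisible by \<open>k\<close> are already excluded, so divisibility of every
  period leaves no cube at all.\<close>

lemma cubefree_lengthI:
  assumes "\<And>w i p. w \<in> lists {0, 1} \<Longrightarrow> cubefree w \<Longrightarrow> cube_at (subst w) i p \<Longrightarrow> k dvd p"
  shows "cubefree_length k"
proof -
  have "subst w \<in> lists {0, 1}" if "w \<in> lists {0, 1}" for w
    using that set_block unfolding subst_def by (fastforce simp: in_lists_conv_set)
  then have "morphism_on {0, 1} subst"
    unfolding morphism_on_def by (auto simp: subst_def)
  moreover have "cubefree (subst w)" if "w \<in> lists {0, 1}" "cubefree w" for w
    using assms cube_period_not_dvd that unfolding cubefree_iff_cube_at[of "subst w"] by blast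
  moreover have "uniform_on {0, 1} k subst"
    unfolding uniform_on_def subst_def using length_block by simp
  ultimately show ?thesis unfolding cubefree_length_def cubefree_morphism_on_def by blast
qed

end


section \<open>The Thue-Morse morphism and block length 2\<close>

text \<open>A shift by an odd \<open>p\<close> exchanges even and odd positions, so the change of
  letter inside the pairs at \<open>2 * q\<close> is carried over to the boundaries between pairs.
  Images under the Thue-Morse morphism and the Thue-Morse word both consist of such pairs.\<close>

lemma odd_period_alternates:
  fixes x :: "nat \<Rightarrow> 'a"
  assumes "odd p" and period: "\<And>j. j \<le> p \<Longrightarrow> x (i + j) = x (i + j + p)"
    and blocks: "\<And>q. i \<le> 2 * q \<Longrightarrow> 2 * q < i + 2 * p \<Longrightarrow> x (2 * q) \<noteq> x (2 * q + 1)"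
    and "i \<le> y" "y < i + 2 * p"
  shows "x y \<noteq> x (y + 1)"
proof -
  have first: "x (i + j) \<noteq> x (i + j + 1)" if "j < p" for j
  proof (cases "even (i + j)")
    case True
    then show ?thesis using blocks[of "(i + j) div 2"] that by simp
  next
    case False
    then have "even (i + j + p)" using \<open>odd p\<close> by simp
    then have "x (i + j + p) \<noteq> x (i + j + p + 1)"
      using blocks[of "(i + j + p) div 2"] that by simp
    then show ?thesis using period[of j] period[of "j + 1"] that by (simp add: algebra_simps)
  qed
  show ?thesis
  proof (cases "y < i + p")
    case True
    then show ?thesis using first[of "y - i"] \<open>i \<le> y\<close> by simp
  next
    case False
    then show ?thesis
      using first[of "y - i - p"] period[of "y - i - p"] period[of "y - i - p + 1"] \<open>y < i + 2 * p\<close>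
      by (simp add: algebra_simps)
  qed
qed

lemma cubefree_length_2: "cubefree_length 2"
proof -
  define B :: "nat \<Rightarrow> nat list" where "B a = (if a = 0 then [0, 1] else [1, 0])" for a
  interpret binary_blocks B 2
    by unfold_locales (auto simp: B_def)
  show ?thesis
  proof (rule cubefree_lengthI, rule ccontr)
    fix w i p
    assume w: "w \<in> lists {0, 1}" "cubefree w" and c: "cube_at (subst w) i p" and "\<not> 2 dvd p"
    have p: "0 < p" "i + 3 * p \<le> 2 * length w"
      and eq: "\<And>j. j < 2 * p \<Longrightarrow> subst w ! (i + j) = subst w ! (i + j + p)"
      using c length_subst[OF w(1)] by (auto simp: cube_at_def)
    have letter: "w ! q \<in> {0, 1}" if "q < length w" for q using w(1) that by auto
    have even: "subst w ! (2 * q) = w ! q" and odd: "subst w ! (2 * q + 1) = 1 - w ! q"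
      if "q < length w" for q
      using subst_nth[OF w(1) that, of 0] subst_nth[OF w(1) that, of 1] letter[OF that]
      by (auto simp: B_def)
    have alt: "subst w ! y \<noteq> subst w ! (y + 1)" if "i \<le> y" "y < i + 2 * p" for y
    proof (rule odd_period_alternates[of p "(!) (subst w)" i])
      show "subst w ! (i + j) = subst w ! (i + j + p)" if "j \<le> p" for j
        using eq that p by simp
      show "subst w ! (2 * q) \<noteq> subst w ! (2 * q + 1)" if "2 * q < i + 2 * p" for q
      proof -
        have q: "q < length w" using that p by linarith
        then show ?thesis using even[OF q] odd[OF q] letter[OF q] by auto
      qed
    qed (use that \<open>\<not> 2 dvd p\<close> in auto)
    have "p \<noteq> 1" using alt[of i] eq[of 0] by auto
    moreover have "p \<noteq> 2" using \<open>\<not> 2 dvd p\<close> by auto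
    ultimately have p3: "3 \<le> p" using p(1) by linarith
    define q where "q = i div 2"
    have q: "2 * q \<le> i" "i \<le> 2 * q + 1" by (simp_all add: q_def)
    \<comment> \<open>The letter after the block boundary differs from the one before it, which is
      the complement of \<open>w ! n\<close>, so consecutive letters of \<open>w\<close> agree. Two
      such boundaries give a cube of single letters.\<close>
    have step: "w ! n = w ! (n + 1)" if "q \<le> n" "n \<le> q + 1" for n
    proof -
      have n: "n + 1 < length w" using that q p p3 by linarith
      have "subst w ! (2 * n + 1) \<noteq> subst w ! (2 * (n + 1))"
        using alt[of "2 * n + 1"] that q p3 by simp
      then show ?thesis using n odd[of n] even[of "n + 1"] letter[of n] letter[of "n + 1"] by auto
    qed
    have "q + 3 \<le> length w" using q p p3 by linarith
    moreover have "w ! (q + j) = w ! (q + j + 1)" if "j < 2" for j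
      using step[of "q + j"] that by simp
    ultimately have "cube_at w q 1" by (simp add: cube_at_def)
    then show False using w(2) by (simp add: cubefree_iff_cube_at)
  qed
qed

section \<open>Block pairs verified by computation\<close>

text \<open>The check \<open>sync_pair u v n\<close> says that a window of length \<open>n\<close> in an image determines its
  position modulo the block length, so a cube of period \<open>p\<close> with \<open>n \<le> 2 * p\<close> has a period
  divisible by the block length. The numerical conditions ensure that windows fit into two
  blocks and the remaining cubes into three.\<close>

definition sync_windows :: "nat list \<Rightarrow> nat list \<Rightarrow> nat \<Rightarrow> nat list list list" where
  "sync_windows u v n =
     map (\<lambda>i. remdups (map (\<lambda>x. take n (drop i x)) [u @ u, u @ v, v @ u, v @ v])) [0..<length u]"

definition no_short_cubes :: "nat list \<Rightarrow> nat list \<Rightarrow> nat \<Rightarrow> bool" where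
  "no_short_cubes u v n \<longleftrightarrow>
     list_all (\<lambda>x. list_all (\<lambda>p. list_all (\<lambda>i. take (2 * p) (drop i x) \<noteq> take (2 * p) (drop (i + p) x))
       [0..<length u]) [1..<n])
     [u @ u @ u, u @ u @ v, u @ v @ u, u @ v @ v, v @ u @ u, v @ u @ v, v @ v @ u, v @ v @ v]"

definition sync_pair :: "nat list \<Rightarrow> nat list \<Rightarrow> nat \<Rightarrow> bool" where
  "sync_pair u v n \<longleftrightarrow> length u = length v \<and> set u \<union> set v \<subseteq> {0, 1} \<and> u \<noteq> v \<and> n \<le> length u + 1 \<and>
     3 * n \<le> 4 * length u + 5 \<and> distinct (concat (sync_windows u v n)) \<and> no_short_cubes u v ((n + 1) div 2)"

lemma cubefree_length_sync_pair:
  assumes "sync_pair u v n" and k_def: "length u = k"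
  shows "cubefree_length k"
proof -
  define B where "B a = (if a = 0 then u else v)" for a :: nat
  have sp: "length u = length v" "set u \<union> set v \<subseteq> {0, 1}" "u \<noteq> v" "n \<le> k + 1"
    "3 * n \<le> 4 * k + 5" "distinct (concat (sync_windows u v n))"
    "no_short_cubes u v ((n + 1) div 2)"
    using assms(1) unfolding sync_pair_def k_def by blast+
  interpret binary_blocks B k
    using sp by unfold_locales (auto simp: B_def k_def)
  have lenW: "length (sync_windows u v n) = k" by (simp add: sync_windows_def k_def)
  have inW: "take n (drop r (B a @ B b)) \<in> set (sync_windows u v n ! r)" if "r < k" for a b r
  proof -
    have "B a @ B b \<in> set [u @ u, u @ v, v @ u, v @ v]" by (simp add: B_def)
    moreover have "sync_windows u v n ! r =
        remdups (map (\<lambda>x. take n (drop r x)) [u @ u, u @ v, v @ u, v @ v])"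
      using that unfolding sync_windows_def k_def by (simp only: nth_map_upt minus_nat.diff_0 add_0)
    ultimately show ?thesis by (simp only: set_remdups set_map) (rule imageI)
  qed
  \<comment> \<open>\<open>remdups\<close> only merges equal windows of one offset, so distinctness
    of the concatenation separates the windows of different offsets.\<close>
  have sync: "r = s" if "r < k" "s < k" "x \<in> set (sync_windows u v n ! r)"
    "x \<in> set (sync_windows u v n ! s)" for r s x
  proof (rule ccontr)
    assume "r \<noteq> s"
    have "[] \<notin> set (sync_windows u v n)"
      unfolding sync_windows_def set_map image_iff remdups_eq_nil_right_iff by simp
    then have "distinct (sync_windows u v n)"
      using sp(6) by (simp add: distinct_concat_iff)
    then have "sync_windows u v n ! r \<noteq> sync_windows u v n ! s"
      using that lenW \<open>r \<noteq> s\<close> by (simp add: nth_eq_iff_index_eq)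
    moreover have "sync_windows u v n ! r \<in> set (sync_windows u v n)"
      "sync_windows u v n ! s \<in> set (sync_windows u v n)"
      using that lenW by simp_all
    ultimately have "set (sync_windows u v n ! r) \<inter> set (sync_windows u v n ! s) = {}"
      using sp(6) unfolding distinct_concat_iff by blast
    then show False using that by blast
  qed
  show ?thesis
  proof (rule cubefree_lengthI)
    fix w i p
    assume w: "w \<in> lists {0, 1}" "cubefree w" and c: "cube_at (subst w) i p"
    have p: "0 < p" "i + 3 * p \<le> k * length w"
      and eq: "\<And>j. j < 2 * p \<Longrightarrow> subst w ! (i + j) = subst w ! (i + j + p)"
      using c length_subst[OF w(1)] by (auto simp: cube_at_def)
    have block: "x div k < length w" if "x < k * length w" for x
      using that k_pos by (simp add: div_less_iff_less_mult mult.commute)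
    show "k dvd p"
    proof (cases "n \<le> 2 * p")
      case True
      have window: "take n (drop x (subst w)) \<in> set (sync_windows u v n ! (x mod k))"
        if xn: "x + n \<le> k * length w" and xw: "x < k * length w" for x
      proof -
        have x: "x = k * (x div k) + x mod k" "x mod k < k" using k_pos by simp_all
        obtain b c where bc: "b \<in> {0, 1}" "c \<in> {0, 1}"
          "\<And>y. y < 3 * k \<Longrightarrow> k * (x div k) + y < k * length w \<Longrightarrow>
            subst w ! (k * (x div k) + y) = (B (w ! (x div k)) @ B b @ B c) ! y"
          using subst_nth_triple[OF w(1) block[OF xw]] by blast
        have "w ! (x div k) \<in> {0, 1}" using w(1) block[OF xw] by auto
        then have len: "length (B (w ! (x div k))) = k" "length (B b) = k"
          using length_block bc by blast+
        have "take n (drop x (subst w)) = take n (drop (x mod k) (B (w ! (x div k)) @ B b))"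
        proof (rule nth_equalityI)
          show "length (take n (drop x (subst w))) =
              length (take n (drop (x mod k) (B (w ! (x div k)) @ B b)))"
            using xn x(2) len sp(4) length_subst[OF w(1)] by simp
        next
          fix y assume "y < length (take n (drop x (subst w)))"
          then have y: "y < n" by simp
          have "subst w ! (x + y) = subst w ! (k * (x div k) + (x mod k + y))" by simp
          also have "\<dots> = (B (w ! (x div k)) @ B b @ B c) ! (x mod k + y)"
          proof (rule bc(3))
            show "x mod k + y < 3 * k" using x(2) y sp(4) by linarith
            have "k * (x div k) + (x mod k + y) = x + y" by simp
            then show "k * (x div k) + (x mod k + y) < k * length w" using xn y by linarith
          qed
          also have "\<dots> = (B (w ! (x div k)) @ B b) ! (x mod k + y)"
          proof -
            have "x mod k + y < 2 * k" using x(2) y sp(4) by linarith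
            then show ?thesis
              using len unfolding append_assoc[symmetric] by (subst nth_append) simp
          qed
          finally show "take n (drop x (subst w)) ! y = take n (drop (x mod k) (B (w ! (x div k)) @ B b)) ! y"
            using y xn len x(2) sp(4) length_subst[OF w(1)] by (simp del: take_append drop_append)
        qed
        then show ?thesis using inW x(2) by simp
      qed
      \<comment> \<open>The first \<open>2 * p\<close> letters of the cube recur \<open>p\<close>
        places later, so the windows at \<open>i\<close> and \<open>i + p\<close> coincide and their
        starts agree modulo \<open>k\<close>.\<close>
      have "take n (drop i (subst w)) = take n (drop (i + p) (subst w))"
        using True p eq length_subst[OF w(1)]
        by (intro nth_equalityI) (simp_all add: add.commute add.left_commute)
      then have "i mod k = (i + p) mod k"
        using window[of i] window[of "i + p"] sync[of "i mod k" "(i + p) mod k"] True p k_pos by simp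
      then show ?thesis using mod_eq_dvd_iff_nat[of i "i + p" k] by simp
    next
      case False
      define q r where "q = i div k" and "r = i mod k"
      have i: "i = k * q + r" "r < k" using k_pos by (simp_all add: q_def r_def)
      have "q < length w" using block[of i] p q_def by simp
      then obtain b c where bc: "b \<in> {0, 1}" "c \<in> {0, 1}"
        "\<And>y. y < 3 * k \<Longrightarrow> k * q + y < k * length w \<Longrightarrow>
          subst w ! (k * q + y) = (B (w ! q) @ B b @ B c) ! y"
        using subst_nth_triple[OF w(1)] by blast
      define x where "x = B (w ! q) @ B b @ B c"
      have "w ! q \<in> {0, 1}" using w(1) \<open>q < length w\<close> by auto
      then have len: "length x = 3 * k" using bc length_block by (simp add: x_def)
      \<comment> \<open>From \<open>2 * p < n\<close> and \<open>3 * n \<le> 4 * k + 5\<close>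
        follows \<open>3 * p \<le> 2 * k + 1\<close>, which leaves room for any offset
        \<open>r < k\<close>.\<close>
      have r3: "r + 3 * p \<le> 3 * k" using False i(2) sp(5) by linarith
      have "take (2 * p) (drop r x) = take (2 * p) (drop (r + p) x)"
      proof (rule nth_equalityI)
        show "length (take (2 * p) (drop r x)) = length (take (2 * p) (drop (r + p) x))"
          using r3 len by simp
      next
        fix j assume "j < length (take (2 * p) (drop r x))"
        then have j: "j < 2 * p" by simp
        have "x ! (r + j) = x ! (r + j + p)"
          using eq[OF j] bc(3)[folded x_def, of "r + j"] bc(3)[folded x_def, of "r + j + p"] j i p r3
          by (simp add: add.assoc)
        then show "take (2 * p) (drop r x) ! j = take (2 * p) (drop (r + p) x) ! j"
          using j r3 len by (simp add: ac_simps)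
      qed
      moreover have "x \<in> set [u @ u @ u, u @ u @ v, u @ v @ u, u @ v @ v,
          v @ u @ u, v @ u @ v, v @ v @ u, v @ v @ v]"
        unfolding x_def B_def by (cases "w ! q = 0"; cases "b = 0"; cases "c = 0") simp_all
      moreover have "p \<in> set [1..<(n + 1) div 2]" "r \<in> set [0..<length u]"
        using False p(1) i(2) unfolding set_upt k_def by simp_all
      ultimately show ?thesis
        using sp(7) unfolding no_short_cubes_def list_all_iff by blast
    qed
  qed
qed

section \<open>The Thue-Morse word and its freeness of overlaps\<close>

text \<open>This is the parity of the number of ones in the binary expansion, and also the fixed
  point, starting with 0, of \<open>0 -> 01\<close>, \<open>1 -> 10\<close>.\<close>

fun thue :: "nat \<Rightarrow> nat" where
  "thue n = (if n = 0 then 0 else if even n then thue (n div 2) else 1 - thue (n div 2))"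

declare thue.simps [simp del]

lemma thue_double [simp]: "thue (2 * n) = thue n"
  by (subst thue.simps) (auto simp: thue.simps[of 0])

lemma thue_double_Suc [simp]: "thue (Suc (2 * n)) = 1 - thue n"
  by (subst thue.simps) simp

lemma thue_double_shift:
  "thue (2 * n + 1) = 1 - thue n"
  "thue (2 * n + 2) = thue (n + 1)" "thue (2 * n + 3) = 1 - thue (n + 1)"
  "thue (2 * n + 4) = thue (n + 2)" "thue (2 * n + 5) = 1 - thue (n + 2)"
  using thue_double_Suc[of n] thue_double[of "n + 1"] thue_double_Suc[of "n + 1"]
    thue_double[of "n + 2"] thue_double_Suc[of "n + 2"]
  by (simp_all only: distrib_left Suc_eq_plus1 add.assoc) simp_all

lemma thue_cases: "thue n = 0 \<or> thue n = 1"
proof (induction n rule: thue.induct)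
  case (1 n)
  then show ?case by (subst (1 2) thue.simps) auto
qed

lemma thue_even_neq: "thue (2 * n) \<noteq> thue (2 * n + 1)"
  using thue_cases[of n] by auto

text \<open>An overlap of even period descends to one of half the period. An odd period makes the
  letters alternate and forces three equal consecutive letters further down, although one of two
  adjacent pairs starts at an even position and so has different letters.\<close>

lemma thue_overlap_free:
  assumes "0 < p" "\<And>j. j \<le> p \<Longrightarrow> thue (i + j) = thue (i + j + p)"
  shows False
  using assms
proof (induction p arbitrary: i rule: less_induct)
  case (less p)
  show False
  proof (cases "even p")
    case True
    then obtain c where c: "p = 2 * c" by blast
    define a e where "a = i div 2" and "e = i mod 2"
    have i: "i = 2 * a + e" "e \<le> 1" by (simp_all add: a_def e_def)
    have inj: "thue x = thue y" if "thue (2 * x + e) = thue (2 * y + e)" for x y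
      using that i(2) thue_cases[of x] thue_cases[of y] by (cases "e = 0") (auto simp: le_Suc_eq)
    \<comment> \<open>Reading every second letter undoes the Thue-Morse morphism: position
      \<open>2 * x + e\<close> holds the letter at \<open>x\<close> or its complement, according to
      the parity \<open>e\<close> of \<open>i\<close>.\<close>
    have "thue (a + j) = thue (a + j + c)" if "j \<le> c" for j
    proof (rule inj)
      have "i + 2 * j = 2 * (a + j) + e" "i + 2 * j + p = 2 * (a + j + c) + e" "2 * j \<le> p"
        using i(1) c that by simp_all
      then show "thue (2 * (a + j) + e) = thue (2 * (a + j + c) + e)"
        using less.prems(2) by metis
    qed
    then show False using less.IH[of c a] less.prems(1) c by auto
  next
    case False
    have alt: "thue y \<noteq> thue (y + 1)" if "i \<le> y" "y < i + 2 * p" for y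
      using False less.prems(2) thue_even_neq that by (rule odd_period_alternates)
    have "p \<noteq> 1" using alt[of i] less.prems(2)[of 0] by auto
    moreover have "p \<noteq> 2" using False by auto
    ultimately have p3: "3 \<le> p" using less.prems(1) by linarith
    define q where "q = i div 2"
    have q: "2 * q \<le> i" "i \<le> 2 * q + 1" by (simp_all add: q_def)
    have step: "thue n = thue (n + 1)" if "q \<le> n" "n \<le> q + 1" for n
    proof -
      have "thue (2 * n + 1) \<noteq> thue (2 * (n + 1))"
        using alt[of "2 * n + 1"] that q p3 by simp
      then show ?thesis
        using thue_cases[of n] thue_cases[of "n + 1"] thue_double[of "n + 1"]
        by (auto simp del: thue_double)
    qed
    have "thue q = thue (q + 1)" "thue (q + 1) = thue (q + 2)"
      using step[of q] step[of "q + 1"] by simp_all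
    moreover have "\<not> (thue q = thue (q + 1) \<and> thue (q + 1) = thue (q + 2))"
      using thue_even_neq[of "q div 2"] thue_even_neq[of "(q + 1) div 2"]
      by (cases "even q") auto
    ultimately show False by blast
  qed
qed

text \<open>Since \<open>n\<close> and \<open>n + 3\<close> have different parity, one of the pairs
  at \<open>n\<close> and \<open>n + 3\<close> starts at an even position and has different letters.
  In particular \<open>00100\<close> does not occur.\<close>

lemma thue_no_marker:
  "\<not> (thue n = 0 \<and> thue (n + 1) = 0 \<and> thue (n + 3) = 0 \<and> thue (n + 4) = 0)"
proof (cases "even n")
  case True
  then show ?thesis using thue_even_neq[of "n div 2"] by auto
next
  case False
  then have "even (n + 3)" by simp
  then show ?thesis using thue_even_neq[of "(n + 3) div 2"] by (auto simp: ac_simps)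
qed

section \<open>Thue-Morse factors with prescribed ends\<close>

text \<open>\<open>P\<close> and \<open>Q\<close> prescribe the letters of the Thue-Morse word from the first and from the last
  position of a factor of length \<open>n + 1\<close>; two different such factors are needed, one per block.\<close>

definition twice :: "(nat \<Rightarrow> bool) \<Rightarrow> (nat \<Rightarrow> bool) \<Rightarrow> nat \<Rightarrow> bool" where
  "twice P Q n \<longleftrightarrow> (\<exists>i j. P i \<and> Q (i + n) \<and> P j \<and> Q (j + n) \<and> (\<exists>s\<le>n. thue (i + s) \<noteq> thue (j + s)))"

lemma twiceI:
  assumes "P i" "Q (i + n)" "P j" "Q (j + n)" "s \<le> n" "thue (i + s) \<noteq> thue (j + s)"
  shows "twice P Q n"
  using assms unfolding twice_def by blast

text \<open>The Thue-Morse morphism maps a factor at \<open>i\<close> to one at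
  \<open>2 * i\<close>; \<open>r\<close> and \<open>t\<close> move its ends, so \<open>m\<close> can
  have either parity. A difference at \<open>s\<close> survives in the first letter of the image
  pair, or in the second one where \<open>r = 1\<close> cuts off the first.\<close>

lemma twice_lift:
  assumes "twice P Q n" "1 \<le> n" "r \<le> 1" "r + m = 2 * n + t"
    and P: "\<And>i. P i \<Longrightarrow> P' (2 * i + r)" and Q: "\<And>i. Q i \<Longrightarrow> Q' (2 * i + t)"
  shows "twice P' Q' m"
proof -
  obtain i j s where ij: "P i" "Q (i + n)" "P j" "Q (j + n)"
    and s: "s \<le> n" "thue (i + s) \<noteq> thue (j + s)"
    using assms(1) unfolding twice_def by blast
  have shift: "2 * x + r + m = 2 * (x + n) + t" for x using assms(4) by simp
  have "P' (2 * i + r)" "P' (2 * j + r)" "Q' (2 * i + r + m)" "Q' (2 * j + r + m)"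
    using ij P Q[of "i + n"] Q[of "j + n"] by (simp_all add: shift)
  moreover have "\<exists>l\<le>m. thue (2 * i + r + l) \<noteq> thue (2 * j + r + l)"
  proof (cases "r = 1 \<and> 1 \<le> s")
    case True
    then have "2 * x + r + (2 * s - 1) = 2 * (x + s)" for x by simp
    moreover have "2 * s - 1 \<le> m" using s(1) assms(4) True by linarith
    ultimately show ?thesis using s(2) thue_double by metis
  next
    case False
    then consider "r = 0" | "r = 1" "s = 0" using assms(3) by linarith
    then show ?thesis
    proof cases
      case 1
      then have "2 * x + r + 2 * s = 2 * (x + s)" for x by simp
      moreover have "2 * s \<le> m" using s(1) assms(4) 1 by linarith
      ultimately show ?thesis using s(2) thue_double by metis
    next
      case 2
      then have "thue (2 * i + r + 0) \<noteq> thue (2 * j + r + 0)"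
        using s(2) thue_cases[of i] thue_cases[of j] by auto
      then show ?thesis by blast
    qed
  qed
  ultimately show ?thesis unfolding twice_def by blast
qed

text \<open>Halving reduces a length from 6 on to one that is at least 3. An odd length is reached
  by ending on the second letter of an image, so \<open>1 - b\<close> is prescribed at the halved
  length.\<close>

lemma twice_letters:
  assumes "3 \<le> n" "a \<le> 1" "b \<le> 1"
  shows "twice (\<lambda>i. thue i = a) (\<lambda>i. thue i = b) n"
  using assms
proof (induction n arbitrary: b rule: less_induct)
  case (less n)
  show ?case
  proof (cases "n \<le> 5")
    case True
    then have "n = 3 \<or> n = 4 \<or> n = 5" "a = 0 \<or> a = 1" "b = 0 \<or> b = 1" using less.prems by auto
    moreover
    have "twice (\<lambda>i. thue i = 0) (\<lambda>i. thue i = 0) 3"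
      by (rule twiceI[of _ 0 _ _ 3 2]) (simp_all add: thue.simps)
    moreover
    have "twice (\<lambda>i. thue i = 0) (\<lambda>i. thue i = 1) 3"
      by (rule twiceI[of _ 5 _ _ 10 1]) (simp_all add: thue.simps)
    moreover
    have "twice (\<lambda>i. thue i = 1) (\<lambda>i. thue i = 0) 3"
      by (rule twiceI[of _ 2 _ _ 7 1]) (simp_all add: thue.simps)
    moreover
    have "twice (\<lambda>i. thue i = 1) (\<lambda>i. thue i = 1) 3"
      by (rule twiceI[of _ 1 _ _ 4 1]) (simp_all add: thue.simps)
    moreover
    have "twice (\<lambda>i. thue i = 0) (\<lambda>i. thue i = 0) 4"
      by (rule twiceI[of _ 5 _ _ 6 1]) (simp_all add: thue.simps)
    moreover
    have "twice (\<lambda>i. thue i = 0) (\<lambda>i. thue i = 1) 4"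
      by (rule twiceI[of _ 0 _ _ 3 2]) (simp_all add: thue.simps)
    moreover
    have "twice (\<lambda>i. thue i = 1) (\<lambda>i. thue i = 0) 4"
      by (rule twiceI[of _ 1 _ _ 2 1]) (simp_all add: thue.simps)
    moreover
    have "twice (\<lambda>i. thue i = 1) (\<lambda>i. thue i = 1) 4"
      by (rule twiceI[of _ 4 _ _ 7 1]) (simp_all add: thue.simps)
    moreover
    have "twice (\<lambda>i. thue i = 0) (\<lambda>i. thue i = 0) 5"
      by (rule twiceI[of _ 0 _ _ 5 1]) (simp_all add: thue.simps)
    moreover
    have "twice (\<lambda>i. thue i = 0) (\<lambda>i. thue i = 1) 5"
      by (rule twiceI[of _ 3 _ _ 6 2]) (simp_all add: thue.simps)
    moreover
    have "twice (\<lambda>i. thue i = 1) (\<lambda>i. thue i = 0) 5"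
      by (rule twiceI[of _ 1 _ _ 4 1]) (simp_all add: thue.simps)
    moreover
    have "twice (\<lambda>i. thue i = 1) (\<lambda>i. thue i = 1) 5"
      by (rule twiceI[of _ 2 _ _ 8 2]) (simp_all add: thue.simps)
    ultimately show ?thesis by blast
  next
    case False
    then have n: "3 \<le> n div 2" "n div 2 < n" by auto
    show ?thesis
    proof (cases "even n")
      case True
      then show ?thesis
        using twice_lift[OF less.IH[OF n(2,1) less.prems(2,3)], of 0 n 0] n by auto
    next
      case False
      then have "0 + n = 2 * (n div 2) + 1" by simp
      moreover have "1 - b \<le> (1 :: nat)" by simp
      ultimately show ?thesis
        using twice_lift[OF less.IH[OF n(2,1) less.prems(2)], of "1 - b" 0 n 1] n less.prems(3) by auto
    qed
  qed
qed

text \<open>Ending the lift on an even position puts the whole image of \<open>b\<close> there; an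
  odd \<open>n\<close> is obtained at the start, by beginning with the second letter of the image of
  \<open>1 - a\<close>.\<close>

lemma twice_letter_block:
  assumes "5 \<le> n" "a \<le> 1" "b \<le> 1"
  shows "twice (\<lambda>i. thue i = a) (\<lambda>i. thue i = b \<and> thue (i + 1) = 1 - b) n"
proof (cases "even n")
  case True
  then have "3 \<le> n div 2" using assms(1) by presburger
  then show ?thesis
    using twice_lift[OF twice_letters[OF _ assms(2,3)], of "n div 2" 0 n 0] True by auto
next
  case False
  have n: "1 + n = 2 * (n div 2 + 1) + 0" "3 \<le> n div 2 + 1" using False assms(1) by presburger+
  have "1 - a \<le> (1 :: nat)" by simp
  then show ?thesis
    using twice_lift[OF twice_letters[OF n(2) _ assms(3)] _ _ n(1), of "1 - a"] assms(2) by auto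
qed

text \<open>The square straddles the images of \<open>1 - b\<close> and \<open>b\<close>, so the
  lift ends on an odd position.\<close>

lemma twice_letter_square:
  assumes "10 \<le> n" "a \<le> 1" "b \<le> 1"
  shows "twice (\<lambda>i. thue i = a) (\<lambda>i. thue i = b \<and> thue (i + 1) = b) n"
proof -
  have n: "5 \<le> n div 2" using assms(1) by simp
  have b: "1 - b \<le> 1" "1 - (1 - b) = b" using assms(3) by auto
  have Q: "thue (2 * i + 1) = b \<and> thue (2 * i + 1 + 1) = b"
    if "thue i = 1 - b \<and> thue (i + 1) = 1 - (1 - b)" for i
    using that assms(3) thue_double[of "i + 1"] by (auto simp del: thue_double)
  show ?thesis
  proof (cases "even n")
    case True
    then have "1 + n = 2 * (n div 2) + 1" by simp
    moreover have "1 - a \<le> (1 :: nat)" by simp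
    ultimately show ?thesis
      using twice_lift[OF twice_letter_block[OF n _ b(1)], of "1 - a" 1 n 1] Q n assms(2) by auto
  next
    case False
    then have "0 + n = 2 * (n div 2) + 1" by simp
    then show ?thesis
      using twice_lift[OF twice_letter_block[OF n assms(2) b(1)], of 0 n 1] Q n by auto
  qed
qed

text \<open>The Thue-Morse morphism turns these into \<open>1001\<close> and \<open>011001\<close>.
  The first supplies the \<open>100\<close> after the two leading zeros of a block, the second the
  final \<open>11\<close> of the block and, beyond it, the \<open>001\<close> with which every block
  starts.\<close>

abbreviation "at_10 i \<equiv> thue i = 1 \<and> thue (i + 1) = 0"
abbreviation "at_010 i \<equiv> thue i = 0 \<and> thue (i + 1) = 1 \<and> thue (i + 2) = 0"

text \<open>\<open>010\<close> starts on an even position in the image of \<open>00\<close> and on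
  an odd one in the image of \<open>11\<close>; the parity of \<open>n\<close> decides between
  them.\<close>

lemma twice_10_010:
  assumes "20 \<le> n"
  shows "twice at_10 at_010 n"
proof -
  have n: "10 \<le> n div 2" using assms by simp
  have P: "at_10 (2 * i + 0)" if "thue i = 1" for i using that by simp
  show ?thesis
  proof (cases "even n")
    case True
    have Q: "at_010 (2 * i + 0)" if "thue i = 0 \<and> thue (i + 1) = 0" for i
      using that thue_double_shift[of i] by simp
    show ?thesis
      using twice_lift[OF twice_letter_square[OF n, of 1 0], of 0 n 0 at_10 at_010] P Q n True by auto
  next
    case False
    have Q: "at_010 (2 * i + 1)" if "thue i = 1 \<and> thue (i + 1) = 1" for i
      using that thue_double_shift[of i] by (simp add: numeral_3_eq_3)
    show ?thesis
      using twice_lift[OF twice_letter_square[OF n, of 1 1], of 0 n 1 at_10 at_010] P Q n False by auto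
  qed
qed

section \<open>Marker blocks of odd length\<close>

text \<open>The blocks have the form \<open>00100 u\<close> where \<open>100 u 001\<close> is a factor of the Thue-Morse word.\<close>

lemma cubefree_length_marker:
  assumes "20 \<le> m"
  shows "cubefree_length (2 * m + 5)"
proof -
  obtain i0 i1 s where occ: "at_10 i0" "at_010 (i0 + m)" "at_10 i1" "at_010 (i1 + m)"
    and s: "s \<le> m" "thue (i0 + s) \<noteq> thue (i1 + s)"
    using twice_10_010[OF assms] unfolding twice_def by blast
  define k where "k = 2 * m + 5"
  define e where "e a = (if a = 0 then i0 else i1)" for a :: nat
  \<comment> \<open>Two zeros are followed by \<open>2 * m + 3\<close> Thue-Morse letters from an
    even position; these begin with \<open>100\<close> and so complete the marker
    \<open>00100\<close>.\<close>
  define B where "B a = map (\<lambda>x. if x < 2 then 0 else thue (2 * e a + (x - 2))) [0..<k]" for a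
  have k: "45 \<le> k" using assms by (simp add: k_def)
  have e: "at_10 (e a)" "at_010 (e a + m)" for a using occ by (simp_all add: e_def)
  have B_nth: "B a ! x = (if x < 2 then 0 else thue (2 * e a + (x - 2)))" if "x < k" for a x
    using that by (simp add: B_def)
  interpret binary_blocks B k
  proof
    show "set (B a) \<subseteq> {0, 1}" for a using thue_cases by (auto simp: B_def) (metis One_nat_def neq0_conv)
    show "length (B a) = k" for a by (simp add: B_def)
    have "B 0 ! (2 * s + 2) \<noteq> B 1 ! (2 * s + 2)"
      using s thue_double[of "i0 + s"] thue_double[of "i1 + s"] B_nth[of "2 * s + 2"]
      by (simp add: k_def e_def algebra_simps)
    then show "B 0 \<noteq> B 1" by auto
  qed
  have start: "thue (2 * e a) = 1" "thue (2 * e a + 1) = 0" "thue (2 * e a + 2) = 0"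
      "thue (2 * e a + 3) = 1" "thue (2 * e a + 5) = 1 - thue (2 * e a + 4)" for a
    using e(1)[of a] thue_double_shift[of "e a"] by simp_all
  \<comment> \<open>The first two values are the end of the block; the other three lie beyond it and
    agree with the \<open>001\<close> starting the next block.\<close>
  have final: "thue (2 * e a + (k - 4)) = 1" "thue (2 * e a + (k - 3)) = 1"
      "thue (2 * e a + (k - 2)) = 0" "thue (2 * e a + (k - 1)) = 0" "thue (2 * e a + k) = 1" for a
  proof -
    have "2 * e a + (k - 4) = 2 * (e a + m) + 1" "2 * e a + (k - 3) = 2 * (e a + m) + 2"
      "2 * e a + (k - 2) = 2 * (e a + m) + 3" "2 * e a + (k - 1) = 2 * (e a + m) + 4"
      "2 * e a + k = 2 * (e a + m) + 5"
      by (simp_all add: k_def)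
    then show "thue (2 * e a + (k - 4)) = 1" "thue (2 * e a + (k - 3)) = 1"
      "thue (2 * e a + (k - 2)) = 0" "thue (2 * e a + (k - 1)) = 0" "thue (2 * e a + k) = 1"
      using e(2)[of a] by (simp_all only: thue_double_shift)
  qed
  have "cubefree_length k"
  proof (rule cubefree_lengthI)
    fix w i p
    assume w: "w \<in> lists {0, 1}" "cubefree w" and c: "cube_at (subst w) i p"
    define W where "W n = subst w ! n" for n
    have p: "0 < p" "i + 3 * p \<le> k * length w" and eq: "\<And>j. j < 2 * p \<Longrightarrow> W (i + j) = W (i + j + p)"
      using c length_subst[OF w(1)] by (auto simp: cube_at_def W_def)
    have block: "q < length w" if "k * q + x < k * length w" for q x
    proof -
      have "k * q < k * length w" using that by linarith
      then show ?thesis by (simp only: nat_mult_less_cancel_disj)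
    qed
    have W_nth: "W (k * q + x) = (if x < 2 then 0 else thue (2 * e (w ! q) + (x - 2)))"
      if "q < length w" "x < k" for q x
      using subst_nth[OF w(1) that] B_nth[OF that(2)] by (simp add: W_def)
    have W_start: "W (k * q) = 0" "W (k * q + 1) = 0" "W (k * q + 2) = 1" "W (k * q + 3) = 0"
        "W (k * q + 4) = 0" "W (k * q + 5) = 1" "W (k * q + 7) = 1 - W (k * q + 6)"
      if "q < length w" for q
      using W_nth[OF that, of 0] W_nth[OF that, of 1] W_nth[OF that, of 2] W_nth[OF that, of 3]
        W_nth[OF that, of 4] W_nth[OF that, of 5] W_nth[OF that, of 6] W_nth[OF that, of 7]
        start[of "w ! q"] k
      by simp_all
    have W_end: "W (k * q + (k - 2)) = 1" "W (k * q + (k - 1)) = 1" if "q < length w" for q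
    proof -
      have "k - 2 - 2 = k - 4" "k - 1 - 2 = k - 3" "\<not> k - 2 < 2" "\<not> k - 1 < 2" "k - 2 < k" "k - 1 < k"
        using k by linarith+
      then show "W (k * q + (k - 2)) = 1" "W (k * q + (k - 1)) = 1"
        using W_nth[OF that, of "k - 2"] W_nth[OF that, of "k - 1"] final(1,2)[of "w ! q"]
        by (simp_all only: if_False)
    qed
    \<comment> \<open>From offset 2 of a block up to the third letter of the next one, the image
      follows a single Thue-Morse factor.\<close>
    have W_inner: "W (k * q + x) = thue (2 * e (w ! q) + (x - 2))"
      if x: "2 \<le> x" "x < k + 3" "k * q + x < k * length w" for q x
    proof (cases "x < k")
      case True
      then show ?thesis using W_nth[OF block[OF x(3)]] x(1) by simp
    next
      case False
      have "k * q + x = k * (q + 1) + (x - k)" using False by simp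
      then have q: "q + 1 < length w" using block[of "q + 1" "x - k"] x(3) by simp
      have "x = k \<or> x = k + 1 \<or> x = k + 2" using False x(2) by linarith
      moreover have "k * q + k = k * (q + 1)" "k * q + (k + 1) = k * (q + 1) + 1"
        "k * q + (k + 2) = k * (q + 1) + 2" "k + 1 - 2 = k - 1" "k + 2 - 2 = k"
        using k by simp_all
      ultimately show ?thesis using W_start(1-3)[OF q] final(3-5)[of "w ! q"] by metis
    qed
    have no_overlap: False
      if x: "2 \<le> x" "x + 2 * p < k + 3" "k * q + x + 2 * p < k * length w"
        and per: "\<And>j. j \<le> p \<Longrightarrow> W (k * q + x + j) = W (k * q + x + j + p)" for q x
    proof (rule thue_overlap_free[OF p(1)])
      fix j assume j: "j \<le> p"
      have "W (k * q + (x + j)) = thue (2 * e (w ! q) + (x + j - 2))"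
        by (rule W_inner) (use x j in linarith)+
      moreover have "W (k * q + (x + j + p)) = thue (2 * e (w ! q) + (x + j + p - 2))"
        by (rule W_inner) (use x j in linarith)+
      moreover have "2 * e (w ! q) + (x + j - 2) = 2 * e (w ! q) + (x - 2) + j"
        "2 * e (w ! q) + (x + j + p - 2) = 2 * e (w ! q) + (x - 2) + j + p"
        using x(1) by linarith+
      ultimately show "thue (2 * e (w ! q) + (x - 2) + j) = thue (2 * e (w ! q) + (x - 2) + j + p)"
        using per[OF j] by (simp only: add.assoc)
    qed
    \<comment> \<open>At offset 1 the second letter would be the 1 of the marker, at offset
      \<open>k - 1\<close> the first would be the final 1 of the block, and at larger offsets up to
      \<open>k - 2\<close> the five letters lie in a Thue-Morse factor.\<close>
    have marker: "k dvd x"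
      if x: "x + 5 \<le> k * length w" "W x = 0" "W (x + 1) = 0" "W (x + 3) = 0" "W (x + 4) = 0" for x
    proof -
      define q r where "q = x div k" and "r = x mod k"
      have xr: "x = k * q + r" "r < k" using k_pos by (simp_all add: q_def r_def)
      have q: "q < length w" using block[of q r] x(1) xr by simp
      have "r \<noteq> 1" using x(3) W_start(3)[OF q] xr(1) by auto
      moreover have "r \<noteq> k - 1" using x(2) W_end(2)[OF q] xr(1) by auto
      moreover have "\<not> (2 \<le> r \<and> r \<le> k - 2)"
      proof
        assume r: "2 \<le> r \<and> r \<le> k - 2"
        have "W (x + l) = thue (2 * e (w ! q) + (r - 2) + l)" if "l < 5" for l
        proof -
          have "W (k * q + (r + l)) = thue (2 * e (w ! q) + (r + l - 2))"
            by (rule W_inner) (use r that x(1) xr k in linarith)+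
          moreover have "2 * e (w ! q) + (r + l - 2) = 2 * e (w ! q) + (r - 2) + l"
            using r by linarith
          ultimately show ?thesis using xr(1) by (simp only: add.assoc)
        qed
        from this[of 0] this[of 1] this[of 3] this[of 4]
        show False using x(2-5) thue_no_marker[of "2 * e (w ! q) + (r - 2)"] by simp
      qed
      ultimately have "r = 0" using xr(2) by linarith
      then show ?thesis using xr(1) by simp
    qed
    define q r where "q = i div k" and "r = i mod k"
    have i: "i = k * q + r" "r < k" using k_pos by (simp_all add: q_def r_def)
    have q: "q < length w" using block[of q r] i p by simp
    have per: "W (k * q + (r + j)) = W (k * q + (r + j + p))" if "j < 2 * p" for j
      using eq[OF that] i by (simp add: add.assoc)
    show "k dvd p"
    proof (cases "4 \<le> p")
      case p4: True
      show ?thesis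
      proof (cases "\<exists>n. i \<le> k * n \<and> k * n + 5 \<le> i + 3 * p")
        case True
        then obtain n where n: "i \<le> k * n" "k * n + 5 \<le> i + 3 * p" by blast
        have M: "W (k * n) = 0" "W (k * n + 1) = 0" "W (k * n + 3) = 0" "W (k * n + 4) = 0"
          using W_start block[of n 4] n(2) p(2) by simp_all
        show ?thesis
        \<comment> \<open>The marker recurs \<open>p\<close> places later or \<open>p\<close> places
          earlier: if it ends beyond the first two periods, then by \<open>4 \<le> p\<close> its
          five letters start after the first period.\<close>
        proof (cases "k * n + 5 \<le> i + 2 * p")
          case True
          have "W (k * n + l + p) = W (k * n + l)" if "l < 5" for l
            using eq[of "k * n - i + l"] that True n(1) by simp
          from this[of 0] this[of 1] this[of 3] this[of 4] have "k dvd k * n + p"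
            using M n(2) p(2) True by (intro marker) (simp_all add: ac_simps)
          then show ?thesis by (simp add: dvd_add_right_iff)
        next
          case False
          then have le: "i + p \<le> k * n" using p4 by linarith
          have "W (k * n - p + l) = W (k * n + l)" if "l < 5" for l
            using eq[of "k * n - p - i + l"] that le n(2) by simp
          from this[of 0] this[of 1] this[of 3] this[of 4] have "k dvd k * n - p"
            using M n(2) p(2) le by (intro marker) simp_all
          moreover have "k * n = (k * n - p) + p" using le by simp
          ultimately show ?thesis by (metis dvd_add_right_iff dvd_triv_left)
        qed
      next
        case False
        then have no: "\<not> (i \<le> k * n \<and> k * n + 5 \<le> i + 3 * p)" for n by blast
        have r: "0 < r" using no[of q] i p4 by (cases "r = 0") auto
        have "r + 3 * p < k + 5" using no[of "q + 1"] i by simp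
        show ?thesis
        \<comment> \<open>A cube has \<open>p - 1\<close> letters more than an overlap, so for
          \<open>4 \<le> p\<close> a zero at offset 1 and a letter sticking out at the end can be
          cut off.\<close>
        proof (cases "r = 1")
          case True
          have "W (k * q + 2 + j) = W (k * q + 2 + j + p)" if "j \<le> p" for j
            using per[of "j + 1"] that p4 True by (simp add: add.assoc)
          then show ?thesis
            using no_overlap[of 2 q] \<open>r + 3 * p < k + 5\<close> True p4 p(2) i by simp
        next
          case False
          have "W (k * q + r + j) = W (k * q + r + j + p)" if "j \<le> p" for j
            using per[of j] that p4 by (simp add: add.assoc)
          then show ?thesis
            using no_overlap[of r q] \<open>r + 3 * p < k + 5\<close> False r p4 p(2) i by simp
        qed
      qed
    next
      case p3: False
      then have p_cases: "p = 1 \<or> p = 2 \<or> p = 3" using p(1) by linarith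
      consider "r < 2" | "2 \<le> r" "r + 3 * p \<le> k + 3" | "2 \<le> r" "k + 3 < r + 3 * p" by linarith
      then show ?thesis
      proof cases
        case 1
        \<comment> \<open>The block starts with \<open>001001\<close> followed by two different
          letters, which exclude period 3; periods 1 and 2 already fail on the known
          letters.\<close>
        then have "r = 0 \<or> r = 1" by linarith
        then show ?thesis
          using p_cases per[of 0] per[of 1] per[of 2] per[of 3] per[of 4] per[of 5] W_start[OF q]
          by (elim disjE) (simp_all add: numeral_eq_Suc)
      next
        case 2
        have "W (k * q + r + j) = W (k * q + r + j + p)" if "j \<le> p" for j
          using per[of j] that p(1) by (simp add: add.assoc)
        then show ?thesis using no_overlap[of r q] 2 p i by simp
      next
        case 3
        then have "k * (q + 1) + 0 < k * length w" using p(2) i by simp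
        then have q1: "q + 1 < length w" by (rule block)
        have next_block: "k * (q + 1) + x = k * q + (k + x)" for x by simp
        note next_start = W_start[OF q1, unfolded next_block]
        show ?thesis
        proof (cases "r = k - 1")
          case True
          have "p = 2 \<or> p = 3" using p_cases 3 i(2) by linarith
          then show ?thesis
          proof
            assume "p = 2"
            moreover have "r + 0 + 2 = k + 1" using True k by simp
            ultimately show ?thesis using per[of 0] W_end(2)[OF q] next_start True by simp
          next
            assume "p = 3"
            \<comment> \<open>Offsets 3 and 4 of the next block both hold 0 and would be repeated at
              offsets 6 and 7, whose letters differ.\<close>
            have "W (k * q + (r + 4)) = W (k * q + (r + 4 + 3))"
              "W (k * q + (r + 5)) = W (k * q + (r + 5 + 3))"
              using per[of 4] per[of 5] \<open>p = 3\<close> by simp_all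
            moreover have "r + 4 + 3 = k + 6" "r + 5 + 3 = k + 7" "r + 4 = k + 3" "r + 5 = k + 4"
              using True k by linarith+
            ultimately have "W (k * q + (k + 3)) = W (k * q + (k + 6))"
              "W (k * q + (k + 4)) = W (k * q + (k + 7))"
              by (simp_all only:)
            then show ?thesis using next_start(4,5,7) by simp
          qed
        next
          case False
          \<comment> \<open>Offset \<open>k - 2\<close> holds 1, and two or three places later
            stands one of the two zeros starting the next block.\<close>
          define j where "j = k - 2 - r"
          have "r \<le> k - 2" using False i(2) by linarith
          then have j: "r + j = k - 2" "j < 2 * p" using 3 p_cases k by (auto simp: j_def)
          have "p = 2 \<or> p = 3" using p_cases 3 \<open>r \<le> k - 2\<close> by linarith
          moreover have "k - 2 + 2 = k" "k - 2 + 3 = k + 1" using k by simp_all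
          ultimately show ?thesis
            using per[OF j(2)] W_end(1)[OF q] W_start(1,2)[OF q1] next_block[of 0] next_block[of 1]
            unfolding j(1) by (elim disjE) (simp_all add: ac_simps)
        qed
      qed
    qed
  qed
  then show ?thesis by (simp add: k_def)
qed

section \<open>Explicit blocks for small odd lengths\<close>

text \<open>The block pairs and window lengths below were found by computer search.\<close>

lemma cubefree_length_3: "cubefree_length 3"
  by (rule cubefree_length_sync_pair[of "[1,0,1]"
        "[0,0,1]" 3]; code_simp)

lemma cubefree_length_5: "cubefree_length 5"
  by (rule cubefree_length_sync_pair[of "[0,1,1,0,1]"
        "[1,0,0,1,0]" 6]; code_simp)

lemma cubefree_length_7: "cubefree_length 7"
  by (rule cubefree_length_sync_pair[of "[0,0,1,1,0,1,1]"
        "[0,0,1,0,0,1,1]" 7]; code_simp)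

lemma cubefree_length_11: "cubefree_length 11"
  by (rule cubefree_length_sync_pair[of "[0,0,1,0,1,0,0,1,0,1,1]"
        "[0,1,0,0,1,1,0,1,0,1,1]" 7]; code_simp)

lemma cubefree_length_13: "cubefree_length 13"
  by (rule cubefree_length_sync_pair[of "[0,0,1,0,0,1,1,0,0,1,1,0,1]"
        "[0,0,1,1,0,1,1,0,0,1,1,0,1]" 8]; code_simp)

lemma cubefree_length_17: "cubefree_length 17"
  by (rule cubefree_length_sync_pair[of "[0,0,1,0,0,1,0,1,0,0,1,1,0,1,0,1,1]"
        "[0,0,1,0,1,1,0,1,0,0,1,1,0,1,0,1,1]" 7]; code_simp)

lemma cubefree_length_19: "cubefree_length 19"
  by (rule cubefree_length_sync_pair[of "[0,0,1,0,0,1,0,1,0,0,1,1,0,1,1,0,0,1,1]"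
        "[0,0,1,0,1,1,0,1,0,0,1,1,0,1,1,0,0,1,1]" 7]; code_simp)

lemma cubefree_length_23: "cubefree_length 23"
  by (rule cubefree_length_sync_pair[of
        "[0,0,1,0,0,1,1,0,1,0,1,1,0,1,1,0,0,1,0,0,1,0,1]"
        "[0,0,1,0,0,1,1,0,1,0,0,1,0,1,1,0,0,1,0,0,1,0,1]" 8]; code_simp)

lemma cubefree_length_29: "cubefree_length 29"
  by (rule cubefree_length_sync_pair[of
        "[0,0,1,0,0,1,1,0,0,1,0,1,1,0,1,0,1,1,0,1,1,0,0,1,0,0,1,0,1]"
        "[0,0,1,0,0,1,1,0,0,1,0,1,1,0,1,0,0,1,0,1,1,0,0,1,0,0,1,0,1]" 9]; code_simp)

lemma cubefree_length_31: "cubefree_length 31"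
  by (rule cubefree_length_sync_pair[of
        "[0,0,1,0,0,1,1,0,0,1,1,0,1,0,1,1,0,0,1,0,1,1,0,0,1,1,0,0,1,0,1]"
        "[0,0,1,0,0,1,1,0,0,1,1,0,1,1,0,1,0,0,1,0,1,1,0,0,1,1,0,0,1,0,1]" 9]; code_simp)

lemma cubefree_length_37: "cubefree_length 37"
  by (rule cubefree_length_sync_pair[of
        "[0,0,1,0,0,1,0,1,0,0,1,1,0,0,1,0,1,1,0,0,1,0,0,1,1,0,1,1,0,1,0,1,1,0,0,1,1]"
        "[0,0,1,0,0,1,0,1,0,0,1,1,0,0,1,1,0,1,0,0,1,0,0,1,1,0,1,1,0,1,0,1,1,0,0,1,1]" 10]; code_simp)

lemma cubefree_length_41: "cubefree_length 41"
  by (rule cubefree_length_sync_pair[of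
        "[0,0,1,0,0,1,1,0,1,0,0,1,0,1,1,0,1,0,1,1,0,0,1,1,0,1,1,0,0,1,0,1,1,0,0,1,0,0,1,0,1]"
        "[0,0,1,0,0,1,1,0,1,0,0,1,0,1,1,0,1,0,1,1,0,0,1,1,0,1,1,0,1,0,0,1,1,0,0,1,0,0,1,0,1]" 9]; code_simp)

lemma cubefree_length_43: "cubefree_length 43"
  by (rule cubefree_length_sync_pair[of
        "[0,0,1,0,0,1,0,1,1,0,0,1,0,1,0,0,1,1,0,0,1,0,1,1,0,1,1,0,0,1,1,0,1,0,0,1,0,0,1,1,0,1,1]"
        "[0,0,1,0,0,1,0,1,1,0,0,1,0,1,0,0,1,1,0,0,1,0,1,1,0,1,1,0,0,1,1,0,1,1,0,1,0,0,1,1,0,1,1]" 10]; code_simp)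

lemma cubefree_length_small_odd:
  assumes "odd k" "k < 45"
  shows "cubefree_length k"
proof -
  note primes = cubefree_length_3 cubefree_length_5 cubefree_length_7 cubefree_length_11 cubefree_length_13
    cubefree_length_17 cubefree_length_19 cubefree_length_23 cubefree_length_29 cubefree_length_31
    cubefree_length_37 cubefree_length_41 cubefree_length_43
  have "cubefree_length 9" using cubefree_length_mult[OF cubefree_length_3 cubefree_length_3] by simp
  moreover have "cubefree_length 15" using cubefree_length_mult[OF cubefree_length_3 cubefree_length_5] by simp
  moreover have "cubefree_length 21" using cubefree_length_mult[OF cubefree_length_3 cubefree_length_7] by simp
  moreover have "cubefree_length 25" using cubefree_length_mult[OF cubefree_length_5 cubefree_length_5] by simp
  moreover have "cubefree_length 27" using cubefree_length_mult[OF cubefree_length_3 \<open>cubefree_length 9\<close>] by simp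
  moreover have "cubefree_length 33" using cubefree_length_mult[OF cubefree_length_3 cubefree_length_11] by simp
  moreover have "cubefree_length 35" using cubefree_length_mult[OF cubefree_length_5 cubefree_length_7] by simp
  moreover have "cubefree_length 39" using cubefree_length_mult[OF cubefree_length_3 cubefree_length_13] by simp
  moreover have "k = 1 \<or> k = 3 \<or> k = 5 \<or> k = 7 \<or> k = 9 \<or> k = 11 \<or> k = 13 \<or> k = 15 \<or>
      k = 17 \<or> k = 19 \<or> k = 21 \<or> k = 23 \<or> k = 25 \<or> k = 27 \<or> k = 29 \<or> k = 31 \<or>
      k = 33 \<or> k = 35 \<or> k = 37 \<or> k = 39 \<or> k = 41 \<or> k = 43"
    using assms by presburger
  ultimately show ?thesis using cubefree_length_1 primes by blast
qed

section \<open>Induction over all block lengths\<close>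

lemma cubefree_length_all: "cubefree_length k"
proof (induction k rule: less_induct)
  case (less k)
  consider "k = 0" | "even k" "2 \<le> k" | "odd k" "k < 45" | "odd k" "45 \<le> k"
    by (metis dvd_imp_le not_gr_zero not_le)
  then show ?case
  proof cases
    case 1
    then show ?thesis using cubefree_length_0 by simp
  next
    case 2
    then have "cubefree_length (2 * (k div 2))"
      by (intro cubefree_length_mult cubefree_length_2 less.IH) simp
    then show ?thesis using 2 by simp
  next
    case 3
    then show ?thesis by (rule cubefree_length_small_odd)
  next
    case 4
    then have "k = 2 * ((k - 5) div 2) + 5" "20 \<le> (k - 5) div 2" by presburger+
    then show ?thesis using cubefree_length_marker by metis
  qed
qed

theorem corollary5:
  fixes k :: nat
  shows "\<exists>h :: nat list \<Rightarrow> nat list. cubefree_morphism_on {0, 1} h \<and> uniform_on {0, 1} k h"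
  using cubefree_length_all[of k] unfolding cubefree_length_def .

end
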